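(* Let $C\subset\mathbb{R}^{n+1}$ be a convex body, $x,y\in C$, $0<r<R$, such that $\overline{B}(y,r)\subset C\subset\overline{B}(x,R)$. Then there exists a constant $M>0$, only depending on $R/r$ and $n$, such that $$I_C(v)\ge M\,\min\{v,|C|-v\}^{n/(n+1)}$$ for all $0\le v\le |C|$.
   Context: Here $n\ge 1$. A convex body in $\mathbb{R}^{n+1}$ is a compact convex set with non-empty interior. $\overline{B}(x,s)$ is the closed Euclidean ball and $|E|$ denotes $(n+1)$-dimensional Lebesgue measure. For measurable $E\subset C$, the relative perimeter is $P_C(E)=\sup\{\int_E \mathrm{div}\,\xi : \xi \text{ smooth vector field with compact support in } \mathrm{int}(C),\ |\xi|\le 1\}$. The isoperimetric profile is $I_C(v)=\inf\{P_C(E): E\subset C,\ |E|=v\}$ for $0\le v\le|C|$. *)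

theory Defs
  imports "HOL-Analysis.Analysis"
begin

definition convex_body :: "'a::euclidean_space set \<Rightarrow> bool" where
  "convex_body C \<longleftrightarrow> compact C \<and> convex C \<and> interior C \<noteq> {}"

text \<open>
  \<open>ck_map k f\<close> says that \<open>f\<close> is of class \<open>C\<^sup>k\<close> on the whole space: a map is of class
  \<open>C\<^sup>k\<^sup>+\<^sup>1\<close> iff it is differentiable and all its directional derivatives are of class \<open>C\<^sup>k\<close>.
\<close>

primrec ck_map :: "nat \<Rightarrow> ('a::euclidean_space \<Rightarrow> 'b::real_normed_vector) \<Rightarrow> bool" where
  "ck_map 0 f \<longleftrightarrow> continuous_on UNIV f"
| "ck_map (Suc k) f \<longleftrightarrow>
     (\<forall>x. f differentiable (at x)) \<and> (\<forall>v. ck_map k (\<lambda>x. frechet_derivative f (at x) v))"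

definition smooth_map :: "('a::euclidean_space \<Rightarrow> 'b::real_normed_vector) \<Rightarrow> bool" where
  "smooth_map f \<longleftrightarrow> (\<forall>k. ck_map k f)"

definition divergence :: "('a::euclidean_space \<Rightarrow> 'a) \<Rightarrow> 'a \<Rightarrow> real" where
  "divergence \<xi> x = (\<Sum>b\<in>Basis. frechet_derivative \<xi> (at x) b \<bullet> b)"

text \<open>
  A vector field with compact support in \<open>interior C\<close> is represented by its extension by zero
  to the whole space, which is smooth there.
\<close>

definition test_fields :: "'a::euclidean_space set \<Rightarrow> ('a \<Rightarrow> 'a) set" where
  "test_fields C = {\<xi>. smooth_map \<xi> \<and>
     compact (closure {x. \<xi> x \<noteq> 0}) \<and> closure {x. \<xi> x \<noteq> 0} \<subseteq> interior C \<and>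
     (\<forall>x. norm (\<xi> x) \<le> 1)}"

text \<open>The relative perimeter may be infinite, hence the extended real values.\<close>

definition relative_perimeter :: "'a::euclidean_space set \<Rightarrow> 'a set \<Rightarrow> ereal" where
  "relative_perimeter C E =
     (SUP \<xi>\<in>test_fields C. ereal (set_lebesgue_integral lebesgue E (divergence \<xi>)))"

definition isoperimetric_profile :: "'a::euclidean_space set \<Rightarrow> real \<Rightarrow> ereal" where
  "isoperimetric_profile C v =
     (INF E\<in>{E. E \<in> sets lebesgue \<and> E \<subseteq> C \<and> measure lebesgue E = v}. relative_perimeter C E)"

end

theory Submission imports Defs begin

text \<open>
  Write \<open>d\<close> for the dimension, \<open>V = |C|\<close>, \<open>D\<close> for a bound of the diameter of \<open>C\<close> and \<open>p\<close> for the relative perimeter of \<open>E\<close>. The proof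
  compares each point \<open>x\<close> of \<open>C\<close> with the points \<open>(1 - \<tau>) x + \<tau> z\<close>, where \<open>z\<close> runs through \<open>C\<close> and \<open>0 < \<tau> \<le> 1 / 2\<close>. By
  convexity these points stay in \<open>C\<close>.

  For fixed \<open>z\<close> the map \<open>x \<mapsto> (1 - \<tau>) x + \<tau> z\<close> moves points by at most \<open>\<tau> D\<close>, so the measure of the set of \<open>x\<close> for which
  exactly one of \<open>x\<close> and its image lies in \<open>E\<close> is at most \<open>\<tau> 2\<^sup>d\<^sup>+\<^sup>1 D p\<close>. This is proved by
  duality, directly from the definition of the perimeter as a supremum (\<open>contraction_crossing_le\<close>): the
  derivative in \<open>s\<close> of a density scaled about \<open>z\<close> with ratio \<open>s\<close> is the divergence of an explicit smooth field
  with compact support (\<open>scaling_flux_le\<close>). Integrating over \<open>z\<close> shows that the set of pairs \<open>(x, z)\<close> such that \<open>E\<close>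
  separates \<open>x\<close> from \<open>(1 - \<tau>) x + \<tau> z\<close> has measure at most \<open>\<tau> 2\<^sup>d\<^sup>+\<^sup>1 D p V\<close>.

  On the other hand, let \<open>F\<close> be the smaller of \<open>E\<close> and \<open>C - E\<close>. For \<open>x\<close> in \<open>F\<close> the points \<open>(1 - \<tau>) x + \<tau> z\<close> fill a set of volume
  \<open>\<tau>\<^sup>d V\<close>. If \<open>\<tau>\<^sup>d V = 2 |F|\<close>, then at least half of the \<open>z\<close> lead out of \<open>F\<close>, and there are pairs of
  measure at least \<open>|F| V / 2\<close> (\<open>crossing_pairs_lower_bound\<close>). Comparison gives \<open>|F| \<le> 2\<^sup>d\<^sup>+\<^sup>2 \<tau> D p\<close>
  with \<open>\<tau>\<close> proportional to \<open>(|F| / V)\<^sup>1\<^sup>/\<^sup>d\<close>, which is the inequality with the sharp exponent. When \<open>F\<close> is so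
  large that this \<open>\<tau>\<close> is above \<open>1 / 2\<close>, the exponent does not matter, and it suffices to join the points
  of \<open>F\<close> to those of \<open>C - F\<close> through the midpoint of the segment between them (\<open>midpoint_crossing_pairs\<close>).
\<close>

section \<open>Smooth functions with compact support\<close>

text \<open>
  These are the functions \<open>e\<^sup>-\<^sup>1\<^sup>/\<^sup>s / s\<^sup>k\<close>, extended by \<open>0\<close> to \<open>s \<le> 0\<close>. The powers of \<open>s\<close> in the denominator
  are there because the derivative of \<open>e\<^sup>-\<^sup>1\<^sup>/\<^sup>s\<close> produces them: the linear span of the family is closed
  under differentiation.
\<close>

definition flat_exp :: "nat \<Rightarrow> real \<Rightarrow> real" where
  "flat_exp k s = (if s > 0 then exp (- (1 / s)) / s ^ k else 0)"

lemma flat_exp_nonneg: "0 \<le> flat_exp k s"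
  by (simp add: flat_exp_def)

text \<open>
  The exponential series dominates its term of order \<open>k + 2\<close> at \<open>1 / s\<close>. Vanishing to second order is what
  makes the extension by zero differentiable at the origin.
\<close>

lemma flat_exp_le: "flat_exp k s \<le> fact (k + 2) * s\<^sup>2"
proof (cases "s > 0")
  case True
  have "(1 / s) ^ (k + 2) / fact (k + 2) \<le> exp (1 / s)"
  proof -
    have "(\<Sum>i\<in>{k + 2}. (1 / s) ^ i /\<^sub>R fact i) \<le> exp (1 / s)"
      unfolding exp_def using True summable_exp_generic[of "1 / s"]
      by (intro sum_le_suminf) auto
    then show ?thesis
      by (simp add: divide_inverse mult.commute del: fact_Suc power_Suc)
  qed
  then have "exp (- (1 / s)) \<le> fact (k + 2) * s ^ (k + 2)"
    using True by (simp add: exp_minus field_simps del: fact_Suc power_Suc)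
  then have "exp (- (1 / s)) / s ^ k \<le> fact (k + 2) * s ^ (k + 2) / s ^ k"
    using True by (intro divide_right_mono) auto
  also have "\<dots> = fact (k + 2) * s\<^sup>2"
    using True by (simp only: power_add) simp
  finally show ?thesis
    using True by (simp add: flat_exp_def del: fact_Suc)
qed (simp add: flat_exp_def)

lemma DERIV_flat_exp:
  "(flat_exp k has_real_derivative (flat_exp (k + 2) s - real k * flat_exp (k + 1) s)) (at s)"
proof -
  consider "s > 0" | "s < 0" | "s = 0" by linarith
  then show ?thesis
  proof cases
    case 1
    have "((\<lambda>s. exp (- (1 / s)) * inverse (s ^ k)) has_real_derivative
        exp (- (1 / s)) * (1 / s\<^sup>2) * inverse (s ^ k)
        + - (inverse (s ^ k) * (real k * s ^ (k - 1)) * inverse (s ^ k)) * exp (- (1 / s))) (at s)"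
      using 1 by (auto intro!: derivative_eq_intros simp: power2_eq_square)
    also have "exp (- (1 / s)) * (1 / s\<^sup>2) * inverse (s ^ k)
        + - (inverse (s ^ k) * (real k * s ^ (k - 1)) * inverse (s ^ k)) * exp (- (1 / s))
        = flat_exp (k + 2) s - real k * flat_exp (k + 1) s"
      using 1 by (cases k) (simp_all add: flat_exp_def power_add power2_eq_square field_simps)
    finally have "((\<lambda>s. exp (- (1 / s)) / s ^ k) has_real_derivative
        (flat_exp (k + 2) s - real k * flat_exp (k + 1) s)) (at s)"
      by (simp add: divide_inverse)
    then show ?thesis
    proof (rule DERIV_cong_ev[OF refl _ refl, THEN iffD2, rotated])
      have "eventually (\<lambda>x. x > 0) (nhds s)"
        using 1 eventually_nhds_in_open[of "{0<..}" s] by simp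
      then show "\<forall>\<^sub>F x in nhds s. flat_exp k x = exp (- (1 / x)) / x ^ k"
        by eventually_elim (simp add: flat_exp_def)
    qed
  next
    case 2
    have "((\<lambda>s. 0) has_real_derivative (flat_exp (k + 2) s - real k * flat_exp (k + 1) s)) (at s)"
      using 2 by (simp add: flat_exp_def)
    then show ?thesis
    proof (rule DERIV_cong_ev[OF refl _ refl, THEN iffD2, rotated])
      have "eventually (\<lambda>x. x < 0) (nhds s)"
        using 2 eventually_nhds_in_open[of "{..<0}" s] by simp
      then show "\<forall>\<^sub>F x in nhds s. flat_exp k x = 0"
        by eventually_elim (simp add: flat_exp_def)
    qed
  next
    case 3
    have "((\<lambda>h. flat_exp k h / h) \<longlongrightarrow> 0) (at 0)"
    proof (rule Lim_null_comparison)
      show "\<forall>\<^sub>F h in at 0. norm (flat_exp k h / h) \<le> fact (k + 2) * \<bar>h\<bar>"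
      proof (rule eventually_at_filter[THEN iffD2], rule always_eventually, intro allI impI)
        fix h :: real assume "h \<noteq> 0"
        have "\<bar>flat_exp k h / h\<bar> = flat_exp k h / \<bar>h\<bar>"
          by (simp add: abs_divide flat_exp_nonneg)
        also have "\<dots> \<le> fact (k + 2) * h\<^sup>2 / \<bar>h\<bar>"
          by (intro divide_right_mono flat_exp_le) auto
        also have "\<dots> = fact (k + 2) * \<bar>h\<bar>"
          using \<open>h \<noteq> 0\<close> by (simp add: power2_eq_square abs_if del: fact_Suc)
        finally show "norm (flat_exp k h / h) \<le> fact (k + 2) * \<bar>h\<bar>" by simp
      qed
      have "((\<lambda>h::real. fact (k + 2) * \<bar>h\<bar>) \<longlongrightarrow> fact (k + 2) * \<bar>0\<bar>) (at 0)"
        by (intro tendsto_intros)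
      then show "((\<lambda>h::real. fact (k + 2) * \<bar>h\<bar>) \<longlongrightarrow> 0) (at 0)" by simp
    qed
    then show ?thesis
      using 3 by (simp add: DERIV_def flat_exp_def[of _ 0])
  qed
qed

text \<open>
  A supply of smooth functions, rich enough to contain bumps. It is generated by operations whose derivatives
  are again expressed by these operations, so that smoothness of all its members follows from one induction
  over first derivatives; no chain rule for higher derivatives has to be proved.
\<close>

inductive_set flat_algebra :: "('a::euclidean_space \<Rightarrow> real) set" where
  const: "(\<lambda>x. c) \<in> flat_algebra"
| inner: "(\<lambda>x. x \<bullet> v) \<in> flat_algebra"
| add: "f \<in> flat_algebra \<Longrightarrow> g \<in> flat_algebra \<Longrightarrow> (\<lambda>x. f x + g x) \<in> flat_algebra"
| mult: "f \<in> flat_algebra \<Longrightarrow> g \<in> flat_algebra \<Longrightarrow> (\<lambda>x. f x * g x) \<in> flat_algebra"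
| flat: "f \<in> flat_algebra \<Longrightarrow> (\<lambda>x. flat_exp k (f x)) \<in> flat_algebra"

lemma flat_algebra_diff:
  "f \<in> flat_algebra \<Longrightarrow> g \<in> flat_algebra \<Longrightarrow> (\<lambda>x. f x - g x) \<in> flat_algebra"
  using flat_algebra.add[OF _ flat_algebra.mult[OF flat_algebra.const[of "-1"]], of f g] by simp

lemma flat_algebra_sum:
  assumes "\<And>i. i \<in> I \<Longrightarrow> f i \<in> flat_algebra"
  shows "(\<lambda>x. \<Sum>i\<in>I. f i x) \<in> flat_algebra"
  using assms
  by (induction I rule: infinite_finite_induct) (auto intro: flat_algebra.const flat_algebra.add)

lemma flat_algebra_dist_sq: "(\<lambda>x. (dist a x)\<^sup>2) \<in> flat_algebra"
proof -
  have "(\<lambda>x. \<Sum>b\<in>Basis. (x \<bullet> b - a \<bullet> b) * (x \<bullet> b - a \<bullet> b)) \<in> flat_algebra"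
    by (intro flat_algebra_sum flat_algebra.mult flat_algebra_diff flat_algebra.inner flat_algebra.const)
  also have "(\<lambda>x. \<Sum>b\<in>Basis. (x \<bullet> b - a \<bullet> b) * (x \<bullet> b - a \<bullet> b)) = (\<lambda>x. (dist a x)\<^sup>2)"
  proof
    fix x
    have "(dist a x)\<^sup>2 = (x - a) \<bullet> (x - a)"
      by (simp add: dist_norm power2_norm_eq_inner inner_diff inner_commute)
    also have "\<dots> = (\<Sum>b\<in>Basis. (x \<bullet> b - a \<bullet> b) * (x \<bullet> b - a \<bullet> b))"
      by (subst euclidean_inner) (simp only: inner_diff_left)
    finally show "(\<Sum>b\<in>Basis. (x \<bullet> b - a \<bullet> b) * (x \<bullet> b - a \<bullet> b)) = (dist a x)\<^sup>2" by simp
  qed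
  finally show ?thesis .
qed

lemma flat_algebra_affine:
  assumes "f \<in> flat_algebra"
  shows "(\<lambda>x. f (a + c *\<^sub>R x)) \<in> flat_algebra"
  using assms
proof induction
  case (inner v)
  have "(\<lambda>x. a \<bullet> v + c * (x \<bullet> v)) \<in> flat_algebra"
    by (intro flat_algebra.intros)
  then show ?case by (simp add: inner_left_distrib)
qed (auto intro: flat_algebra.intros)

text \<open>
  The algebra is closed under directional derivatives; the composition step uses that the derivative of
  \<open>flat_exp k\<close> is a combination of \<open>flat_exp (k + 1)\<close> and \<open>flat_exp (k + 2)\<close>.
\<close>

lemma flat_algebra_derivative:
  assumes "f \<in> flat_algebra"
  obtains f' where "\<And>x. (f has_derivative f' x) (at x)" "\<And>v. (\<lambda>x. f' x v) \<in> flat_algebra"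
proof -
  have "\<exists>f'. (\<forall>x. (f has_derivative f' x) (at x)) \<and> (\<forall>v. (\<lambda>x. f' x v) \<in> flat_algebra)"
    using assms
  proof induction
    case (const c)
    show ?case by (rule exI[of _ "\<lambda>x v. 0"]) (auto intro: flat_algebra.const)
  next
    case (inner w)
    show ?case
      by (rule exI[of _ "\<lambda>x v. v \<bullet> w"]) (auto intro!: derivative_eq_intros flat_algebra.const)
  next
    case (add f g)
    then obtain f' g' where "\<forall>x. (f has_derivative f' x) (at x)" "\<forall>v. (\<lambda>x. f' x v) \<in> flat_algebra"
      "\<forall>x. (g has_derivative g' x) (at x)" "\<forall>v. (\<lambda>x. g' x v) \<in> flat_algebra" by blast
    then show ?case
      by (intro exI[of _ "\<lambda>x v. f' x v + g' x v"])
        (auto intro!: derivative_eq_intros flat_algebra.add)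
  next
    case (mult f g)
    then obtain f' g' where "\<forall>x. (f has_derivative f' x) (at x)" "\<forall>v. (\<lambda>x. f' x v) \<in> flat_algebra"
      "\<forall>x. (g has_derivative g' x) (at x)" "\<forall>v. (\<lambda>x. g' x v) \<in> flat_algebra" by blast
    then show ?case using mult.hyps
      by (intro exI[of _ "\<lambda>x v. f x * g' x v + f' x v * g x"])
        (auto intro!: derivative_eq_intros flat_algebra.intros)
  next
    case (flat f k)
    then obtain f' where f': "\<forall>x. (f has_derivative f' x) (at x)" "\<forall>v. (\<lambda>x. f' x v) \<in> flat_algebra"
      by blast
    have "((\<lambda>x. flat_exp k (f x)) has_derivative
        (\<lambda>v. f' x v * (flat_exp (k + 2) (f x) - real k * flat_exp (k + 1) (f x)))) (at x)" for x
      using f'(1) by (intro DERIV_flat_exp[THEN DERIV_compose_FDERIV]) auto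
    moreover have "(\<lambda>x. f' x v * (flat_exp (k + 2) (f x) - real k * flat_exp (k + 1) (f x))) \<in> flat_algebra" for v
      using f'(2) flat.hyps by (intro flat_algebra.intros flat_algebra_diff) auto
    ultimately show ?case
      by (intro exI[of _ "\<lambda>x v. f' x v * (flat_exp (k + 2) (f x) - real k * flat_exp (k + 1) (f x))"]) simp
  qed
  then show ?thesis using that by blast
qed

lemma flat_algebra_continuous:
  assumes "f \<in> flat_algebra" shows "continuous_on S f"
  using flat_algebra_derivative[OF assms]
  by (meson continuous_at_imp_continuous_on has_derivative_continuous)

text \<open>
  Every directional derivative of such a map is a map of the same kind, hence \<open>ck_map k\<close> follows for all \<open>k\<close>
  by induction on \<open>k\<close>.
\<close>

lemma smooth_map_componentwise:
  fixes \<xi> :: "'a::euclidean_space \<Rightarrow> 'b::euclidean_space"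
  assumes "\<And>b. b \<in> Basis \<Longrightarrow> (\<lambda>x. \<xi> x \<bullet> b) \<in> flat_algebra"
  shows "smooth_map \<xi>"
  unfolding smooth_map_def
proof
  fix k show "ck_map k \<xi>"
    using assms
  proof (induction k arbitrary: \<xi>)
    case 0
    then show ?case by (auto simp: continuous_on_componentwise[of _ \<xi>] intro!: flat_algebra_continuous)
  next
    case (Suc k)
    have "\<forall>b\<in>Basis. \<exists>f'. (\<forall>x. ((\<lambda>x. \<xi> x \<bullet> b) has_derivative f' x) (at x)) \<and> (\<forall>v. (\<lambda>x. f' x v) \<in> flat_algebra)"
      using flat_algebra_derivative Suc.prems by metis
    then obtain F where F: "\<And>b x. b \<in> Basis \<Longrightarrow> ((\<lambda>x. \<xi> x \<bullet> b) has_derivative F b x) (at x)"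
      "\<And>b v. b \<in> Basis \<Longrightarrow> (\<lambda>x. F b x v) \<in> flat_algebra"
      by metis
    define D where "D x v = (\<Sum>b\<in>Basis. F b x v *\<^sub>R b)" for x v
    have D: "(\<xi> has_derivative D x) (at x)" for x
      by (rule has_derivative_componentwise_within[THEN iffD2]) (use F(1) in \<open>auto simp: D_def\<close>)
    have fd: "frechet_derivative \<xi> (at x) = D x" for x
      using frechet_derivative_at[OF D] by simp
    show ?case
    proof (simp add: fd, intro conjI allI)
      show "\<xi> differentiable at x" for x using D differentiable_def by blast
      show "ck_map k (\<lambda>x. D x v)" for v
        by (rule Suc.IH) (use F(2) in \<open>auto simp: D_def\<close>)
    qed
  qed
qed

text \<open>
  A finite sum \<open>\<psi>\<close> of radial bumps is positive on \<open>K\<close> and supported in \<open>U\<close>. By compactness \<open>\<psi> \<ge> m > 0\<close> on \<open>K\<close>, and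
  \<open>t \<mapsto> e\<^sup>-\<^sup>1\<^sup>/\<^sup>t\<close> applied to a large multiple of \<open>\<psi>\<close> turns it into a function that is almost \<open>1\<close> on \<open>K\<close>. An
  error \<open>\<epsilon>\<close> on \<open>K\<close> is harmless for integral estimates, so a plateau of height exactly \<open>1\<close> is not aimed at.
\<close>

lemma flat_algebra_Urysohn:
  fixes K U :: "'a::euclidean_space set"
  assumes "compact K" "open U" "K \<subseteq> U" "0 < \<epsilon>"
  obtains f L where "f \<in> flat_algebra" "\<And>x. 0 \<le> f x" "\<And>x. f x \<le> 1" "\<And>x. x \<in> K \<Longrightarrow> 1 - \<epsilon> \<le> f x"
    "compact L" "L \<subseteq> U" "\<And>x. x \<notin> L \<Longrightarrow> f x = 0"
proof -
  have "\<forall>x\<in>K. \<exists>r>0. cball x r \<subseteq> U"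
    using assms open_contains_cball by blast
  then obtain r where r: "\<And>x. x \<in> K \<Longrightarrow> r x > 0" "\<And>x. x \<in> K \<Longrightarrow> cball x (r x) \<subseteq> U"
    by metis
  have "K \<subseteq> (\<Union>a\<in>K. ball a (r a))" using r(1) by force
  then obtain A where A: "A \<subseteq> K" "finite A" "K \<subseteq> (\<Union>a\<in>A. ball a (r a))"
    using compactE_image[OF assms(1), of K "\<lambda>a. ball a (r a)"] by auto
  define \<psi> where "\<psi> x = (\<Sum>a\<in>A. flat_exp 0 ((r a)\<^sup>2 - (dist a x)\<^sup>2))" for x
  have \<psi>: "\<psi> \<in> flat_algebra"
    unfolding \<psi>_def
    by (intro flat_algebra_sum flat_algebra.flat flat_algebra_diff flat_algebra.const flat_algebra_dist_sq)
  have \<psi>0: "\<psi> x \<ge> 0" for x by (simp add: \<psi>_def sum_nonneg flat_exp_nonneg)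
  define L where "L = (\<Union>a\<in>A. cball a (r a))"
  have out: "\<psi> x = 0" if "x \<notin> L" for x
    unfolding \<psi>_def
  proof (intro sum.neutral ballI)
    fix a assume "a \<in> A"
    then have "r a < dist a x" "0 < r a" using that r(1) A(1) by (auto simp: L_def)
    then have "(r a)\<^sup>2 \<le> (dist a x)\<^sup>2" by (intro power_mono) auto
    then show "flat_exp 0 ((r a)\<^sup>2 - (dist a x)\<^sup>2) = 0" by (simp add: flat_exp_def)
  qed
  have pos: "\<psi> x > 0" if "x \<in> K" for x
  proof -
    have "x \<in> (\<Union>a\<in>A. ball a (r a))" using A(3) that by (rule subsetD)
    then obtain a where a: "a \<in> A" "dist a x < r a" by auto
    then have "(dist a x)\<^sup>2 < (r a)\<^sup>2" by (intro power_strict_mono) auto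
    then show ?thesis
      unfolding \<psi>_def using a(1) A(2)
      by (intro sum_pos2[of A a]) (auto simp: flat_exp_nonneg, simp add: flat_exp_def)
  qed
  obtain m where m: "m > 0" "\<And>x. x \<in> K \<Longrightarrow> m \<le> \<psi> x"
  proof (cases "K = {}")
    case False
    then obtain x0 where "x0 \<in> K" "\<forall>x\<in>K. \<psi> x0 \<le> \<psi> x"
      using continuous_attains_inf[OF assms(1) False flat_algebra_continuous[OF \<psi>]] by blast
    then show ?thesis using pos that by blast
  qed (use that[of 1] in auto)
  \<comment> \<open>With this factor the exponent is at least \<open>- \<epsilon>\<close> on \<open>K\<close>, and \<open>e\<^sup>-\<^sup>\<epsilon> \<ge> 1 - \<epsilon>\<close>.\<close>
  define f where "f x = flat_exp 0 (1 / (\<epsilon> * m) * \<psi> x)" for x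
  show ?thesis
  proof
    show "f \<in> flat_algebra"
      unfolding f_def by (intro flat_algebra.flat flat_algebra.mult flat_algebra.const \<psi>)
    show "0 \<le> f x" for x by (simp add: f_def flat_exp_nonneg)
    show "f x \<le> 1" for x using m(1) \<psi>0[of x] \<open>0 < \<epsilon>\<close> by (simp add: f_def flat_exp_def)
    show "compact L" unfolding L_def using A(2) by (intro compact_UN) auto
    show "L \<subseteq> U" using r(2) A(1) by (auto simp: L_def)
    show "f x = 0" if "x \<notin> L" for x using out[OF that] by (simp add: f_def flat_exp_def)
    show "1 - \<epsilon> \<le> f x" if "x \<in> K" for x
    proof -
      have "1 - \<epsilon> \<le> 1 - \<epsilon> * m / \<psi> x"
        using m that \<open>0 < \<epsilon>\<close> pos[OF that] by (simp add: field_simps)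
      also have "\<dots> \<le> exp (- (\<epsilon> * m / \<psi> x))"
        using exp_ge_add_one_self[of "- (\<epsilon> * m / \<psi> x)"] by simp
      also have "\<dots> = f x"
        using m(1) pos[OF that] \<open>0 < \<epsilon>\<close> by (simp add: f_def flat_exp_def)
      finally show ?thesis .
    qed
  qed
qed

section \<open>Perimeter controls contractions towards a point\<close>

lemma lborel_integral_affine:
  fixes f :: "'a::euclidean_space \<Rightarrow> real"
  assumes [measurable]: "f \<in> borel_measurable borel" and "a > 0"
  shows "(\<integral>x. f x \<partial>lborel) = a ^ DIM('a) * (\<integral>x. f (t + a *\<^sub>R x) \<partial>lborel)"
  using \<open>a > 0\<close>
  by (subst lborel_affine[of a t]) (simp_all add: integral_density integral_distr)

lemma emeasure_lborel_affine:
  fixes S :: "'a::euclidean_space set"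
  assumes [measurable]: "S \<in> sets borel" and "a > 0"
  shows "emeasure lborel S = ennreal (a ^ DIM('a)) * emeasure lborel {x. t + a *\<^sub>R x \<in> S}"
proof -
  have "emeasure lborel S =
      emeasure (density (distr lborel borel (\<lambda>x. t + a *\<^sub>R x)) (\<lambda>_. ennreal (a ^ DIM('a)))) S"
    using \<open>a > 0\<close> by (subst lborel_affine[of a t]) simp_all
  also have "\<dots> = (\<integral>\<^sup>+x. ennreal (a ^ DIM('a)) * indicator S (t + a *\<^sub>R x) \<partial>lborel)"
    by (subst emeasure_density) (simp_all add: nn_integral_distr)
  also have "\<dots> = ennreal (a ^ DIM('a)) * (\<integral>\<^sup>+x. indicator {x. t + a *\<^sub>R x \<in> S} x \<partial>lborel)"
    by (subst nn_integral_cmult[symmetric]) (auto simp: indicator_def intro!: nn_integral_cong)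
  also have "(\<integral>\<^sup>+x. indicator {x. t + a *\<^sub>R x \<in> S} x \<partial>lborel) = emeasure lborel {x. t + a *\<^sub>R x \<in> S}"
    by (rule nn_integral_indicator) measurable
  finally show ?thesis .
qed

text \<open>
  Scaling about \<open>z\<close> moves the points of \<open>C\<close> along rays through \<open>z\<close>; the fields below are the fluxes of a density
  \<open>\<phi>\<close> transported in this way, up to normalisation. They are supported in a copy of \<open>L\<close> contracted
  towards \<open>z\<close>, which stays in the interior of \<open>C\<close> by convexity. The denominator comes from
  \<open>dist z y \<le> D\<close> and \<open>s\<^sup>d\<^sup>-\<^sup>1 \<le> 2\<^sup>d\<close>.
\<close>

lemma radial_test_field:
  fixes \<phi> :: "'a::euclidean_space \<Rightarrow> real"
  assumes C: "convex C" "z \<in> C" and D: "0 < D" "\<And>x. x \<in> C \<Longrightarrow> dist z x \<le> D"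
    and \<phi>: "\<phi> \<in> flat_algebra" "\<And>x. \<bar>\<phi> x\<bar> \<le> 1" "\<And>x. x \<notin> L \<Longrightarrow> \<phi> x = 0"
    and L: "compact L" "L \<subseteq> interior C"
    and s: "1 \<le> s" "s \<le> 2"
  shows "(\<lambda>y. (s ^ (DIM('a) - 1) / (2 ^ DIM('a) * D) * \<phi> ((1 - s) *\<^sub>R z + s *\<^sub>R y)) *\<^sub>R (y - z)) \<in> test_fields C"
    (is "?\<xi> \<in> _")
proof -
  define T where "T x = z - (1 / s) *\<^sub>R (z - x)" for x
  have T: "y = T ((1 - s) *\<^sub>R z + s *\<^sub>R y)" for y
  proof -
    have "z - ((1 - s) *\<^sub>R z + s *\<^sub>R y) = s *\<^sub>R (z - y)" by (simp add: algebra_simps)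
    then show ?thesis using s by (simp add: T_def)
  qed
  have TL: "T ` L \<subseteq> interior C"
    using mem_interior_convex_shrink[OF C(1) _ C(2), of _ "1 / s"] L(2) s by (auto simp: T_def)
  have supp: "closure {x. ?\<xi> x \<noteq> 0} \<subseteq> T ` L"
  proof (rule closure_minimal)
    show "{x. ?\<xi> x \<noteq> 0} \<subseteq> T ` L"
      using T \<phi>(3) by fastforce
    show "closed (T ` L)"
      unfolding T_def by (intro compact_imp_closed compact_continuous_image continuous_intros L)
  qed
  have "compact (T ` L)" unfolding T_def by (intro compact_continuous_image continuous_intros L)
  then have comp: "compact (closure {x. ?\<xi> x \<noteq> 0})"
    using compact_Int_closed[OF _ closed_closure, of "T ` L" "{x. ?\<xi> x \<noteq> 0}"] supp
    by (simp only: Int_absorb1)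
  have "smooth_map ?\<xi>"
  proof (rule smooth_map_componentwise)
    fix b :: 'a assume "b \<in> Basis"
    have "(\<lambda>y. (s ^ (DIM('a) - 1) / (2 ^ DIM('a) * D) * \<phi> ((1 - s) *\<^sub>R z + s *\<^sub>R y)) * (y \<bullet> b - z \<bullet> b)) \<in> flat_algebra"
      by (intro flat_algebra.intros flat_algebra_diff flat_algebra_affine \<phi>)
    then show "(\<lambda>y. ?\<xi> y \<bullet> b) \<in> flat_algebra"
      by (simp add: inner_diff_left)
  qed
  moreover have "norm (?\<xi> y) \<le> 1" for y
  proof (cases "(1 - s) *\<^sub>R z + s *\<^sub>R y \<in> L")
    case True
    then have "y \<in> C" using T[of y] TL interior_subset by blast
    then have 1: "norm (y - z) \<le> D" using D(2) by (simp add: dist_norm norm_minus_commute)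
    have "s ^ (DIM('a) - 1) \<le> 2 ^ (DIM('a) - 1)" using s by (intro power_mono) auto
    also have "\<dots> \<le> 2 ^ DIM('a)" by (intro power_increasing) auto
    finally have 2: "s ^ (DIM('a) - 1) / 2 ^ DIM('a) \<le> 1" by simp
    have "norm (?\<xi> y) = s ^ (DIM('a) - 1) / 2 ^ DIM('a) * \<bar>\<phi> ((1 - s) *\<^sub>R z + s *\<^sub>R y)\<bar> * (norm (y - z) / D)"
      using s D(1) by (simp add: abs_mult)
    also have "\<dots> \<le> 1 * 1 * 1"
      using 1 2 D(1) s \<phi>(2) by (intro mult_mono) auto
    finally show ?thesis by simp
  qed (simp add: \<phi>(3))
  ultimately show ?thesis
    unfolding test_fields_def using comp supp TL by auto
qed

text \<open>
  The density \<open>F s y = s\<^sup>d \<phi>(z + s (y - z))\<close> satisfies the continuity equation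
  \<open>\<partial>F/\<partial>s = div (s\<^sup>d\<^sup>-\<^sup>1 \<phi>(z + s (y - z)) (y - z))\<close>. The vector field on the right is a multiple of a test field, hence
  its divergence integrates over \<open>E\<close> to at most \<open>2\<^sup>d D p\<close> for each \<open>s\<close>; it remains to integrate over \<open>1 \<le> s \<le> c\<close> and
  to exchange the integrals.
\<close>

lemma scaling_flux_le:
  fixes \<phi> :: "'a::euclidean_space \<Rightarrow> real"
  assumes C: "convex C" "compact C" "z \<in> C" and D: "0 < D" "\<And>x. x \<in> C \<Longrightarrow> dist z x \<le> D"
    and E: "E \<in> sets borel" "E \<subseteq> C"
    and p: "\<And>\<xi>. \<xi> \<in> test_fields C \<Longrightarrow> (LINT y:E|lborel. divergence \<xi> y) \<le> p"
    and \<phi>: "\<phi> \<in> flat_algebra" "\<And>x. \<bar>\<phi> x\<bar> \<le> 1" "\<And>x. x \<notin> L \<Longrightarrow> \<phi> x = 0"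
    and L: "compact L" "L \<subseteq> interior C"
    and c: "1 \<le> c" "c \<le> 2"
  shows "(LINT y:E|lborel. c ^ DIM('a) * \<phi> ((1 - c) *\<^sub>R z + c *\<^sub>R y)) - (LINT y:E|lborel. \<phi> y)
    \<le> (c - 1) * (2 ^ DIM('a) * D * p)"
proof -
  let ?d = "DIM('a)"
  obtain \<phi>' where \<phi>': "\<And>x. (\<phi> has_derivative \<phi>' x) (at x)" "\<And>v. (\<lambda>x. \<phi>' x v) \<in> flat_algebra"
    using flat_algebra_derivative[OF \<phi>(1)] by blast
  define A where "A s y = (1 - s) *\<^sub>R z + s *\<^sub>R y" for s y
  define F where "F s y = s ^ ?d * \<phi> (A s y)" for s y
  \<comment> \<open>\<open>G\<close> is the derivative of \<open>F\<close> in \<open>s\<close>. The directional derivative of \<open>\<phi>\<close> is expanded in the basis to make joint continuity visible.\<close>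
  define G where "G s y = real ?d * s ^ (?d - 1) * \<phi> (A s y)
      + s ^ ?d * (\<Sum>b\<in>Basis. ((y - z) \<bullet> b) * \<phi>' (A s y) b)" for s y
  have lin: "linear (\<phi>' x)" for x
    using \<phi>'(1) has_derivative_bounded_linear bounded_linear.linear by blast
  have expand: "\<phi>' x v = (\<Sum>b\<in>Basis. (v \<bullet> b) * \<phi>' x b)" for x v
  proof -
    have "\<phi>' x v = \<phi>' x (\<Sum>b\<in>Basis. (v \<bullet> b) *\<^sub>R b)" by (simp add: euclidean_representation)
    also have "\<dots> = (\<Sum>b\<in>Basis. (v \<bullet> b) * \<phi>' x b)"
      by (simp add: linear_sum[OF lin] linear_cmul[OF lin])
    finally show ?thesis .
  qed
  have cG: "continuous_on UNIV (\<lambda>x. G (fst x) (snd x))"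
    unfolding G_def A_def
    by (intro continuous_intros continuous_on_compose2[OF flat_algebra_continuous[OF \<phi>(1), of UNIV]]
        continuous_on_compose2[OF flat_algebra_continuous[OF \<phi>'(2), of UNIV]]) auto
  have dF: "((\<lambda>s. F s y) has_real_derivative G s y) (at s)" for s y
  proof -
    have "((\<lambda>s. A s y) has_derivative (\<lambda>h. h *\<^sub>R (y - z))) (at s)"
      unfolding A_def by (auto intro!: derivative_eq_intros simp: algebra_simps)
    then have "((\<lambda>s. \<phi> (A s y)) has_derivative (\<lambda>h. \<phi>' (A s y) (h *\<^sub>R (y - z)))) (at s)"
      using \<phi>'(1) has_derivative_compose by blast
    then have "((\<lambda>s. \<phi> (A s y)) has_real_derivative \<phi>' (A s y) (y - z)) (at s)"
      unfolding has_field_derivative_def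
      by (rule has_derivative_eq_rhs) (simp add: linear_cmul[OF lin] fun_eq_iff)
    then show ?thesis
      unfolding F_def G_def expand[symmetric]
      by (auto intro!: derivative_eq_intros simp: algebra_simps)
  qed
  have flux: "(LINT y:E|lborel. G s y) \<le> 2 ^ ?d * D * p" if s: "1 \<le> s" "s \<le> 2" for s
  proof -
    define \<alpha> where "\<alpha> = s ^ (?d - 1) / (2 ^ ?d * D)"
    define \<xi> where "\<xi> y = (\<alpha> * \<phi> (A s y)) *\<^sub>R (y - z)" for y
    have \<xi>: "\<xi> \<in> test_fields C"
      unfolding \<xi>_def A_def \<alpha>_def
      by (rule radial_test_field[OF C(1,3) D \<phi> L s])
    have d\<xi>: "(\<xi> has_derivative
        (\<lambda>v. (\<alpha> * \<phi> (A s y)) *\<^sub>R v + (\<alpha> * (s * \<phi>' (A s y) v)) *\<^sub>R (y - z))) (at y)" for y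
    proof -
      have "(A s has_derivative (\<lambda>v. s *\<^sub>R v)) (at y)"
        unfolding A_def by (auto intro!: derivative_eq_intros)
      then have "((\<lambda>y. \<phi> (A s y)) has_derivative (\<lambda>v. \<phi>' (A s y) (s *\<^sub>R v))) (at y)"
        using \<phi>'(1) has_derivative_compose by blast
      then have "((\<lambda>y. \<phi> (A s y)) has_derivative (\<lambda>v. s * \<phi>' (A s y) v)) (at y)"
        by (simp add: linear_cmul[OF lin])
      then show ?thesis
        unfolding \<xi>_def by (auto intro!: derivative_eq_intros)
    qed
    have "divergence \<xi> y = G s y / (2 ^ ?d * D)" for y
    proof -
      have "s ^ ?d = s * s ^ (?d - 1)" by (simp add: power_eq_if)
      moreover have "divergence \<xi> y = \<alpha> * (real ?d * \<phi> (A s y))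
          + \<alpha> * s * (\<Sum>b\<in>Basis. ((y - z) \<bullet> b) * \<phi>' (A s y) b)"
        unfolding divergence_def frechet_derivative_at[OF d\<xi>, symmetric]
        by (simp add: inner_add_left sum.distrib sum_distrib_left mult_ac)
      ultimately show ?thesis
        unfolding \<alpha>_def G_def by (simp add: add_divide_distrib mult_ac)
    qed
    then have "divergence \<xi> = (\<lambda>y. G s y / (2 ^ ?d * D))" by auto
    with p[OF \<xi>] D(1) show ?thesis
      by (simp add: divide_le_eq mult_ac)
  qed
  define I where "I = {1..c} \<times> E"
  obtain B where B: "\<And>s y. s \<in> {1..2} \<Longrightarrow> y \<in> C \<Longrightarrow> \<bar>G s y\<bar> \<le> B"
  proof -
    have "bounded ((\<lambda>x. G (fst x) (snd x)) ` ({1..2} \<times> C))"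
      by (intro compact_imp_bounded compact_continuous_image compact_Times C continuous_on_subset[OF cG]) auto
    then show ?thesis using that by (fastforce simp: bounded_iff)
  qed
  have "integrable lborel (\<lambda>x::real \<times> 'a. indicator I x *\<^sub>R G (fst x) (snd x))"
  proof (rule integrableI_bounded_set_indicator)
    show I: "I \<in> sets lborel" unfolding I_def using E(1) by (auto intro!: borel_Times)
    show "(\<lambda>x. G (fst x) (snd x)) \<in> borel_measurable lborel"
      using borel_measurable_continuous_onI[OF cG] by simp
    have "bounded I" unfolding I_def
      using bounded_subset[OF compact_imp_bounded[OF C(2)] E(2)] by (intro bounded_Times) auto
    then show "emeasure lborel I < \<infinity>" by (rule emeasure_bounded_finite)
    show "AE x in lborel. x \<in> I \<longrightarrow> norm (G (fst x) (snd x)) \<le> B"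
      using B E(2) c by (intro always_eventually) (auto simp: I_def subset_iff)
  qed
  then have int: "integrable (lborel \<Otimes>\<^sub>M lborel) (\<lambda>(s, y). indicator {1..c} s * (indicator E y * G s y))"
    unfolding lborel_prod by (simp add: I_def indicator_times case_prod_beta' mult_ac)
  have "(LINT y:E|lborel. F c y) - (LINT y:E|lborel. F 1 y) = (LINT y:E|lborel. F c y - F 1 y)"
  proof (rule set_integral_diff(2)[symmetric])
    have "set_integrable lborel E (F s)" for s
    proof (rule set_integrable_subset[OF borel_integrable_compact[OF C(2), unfolded set_integrable_def[symmetric]]])
    qed (use E in \<open>auto simp: F_def A_def intro!: continuous_intros continuous_on_compose2[OF flat_algebra_continuous[OF \<phi>(1), of UNIV]]\<close>)
    then show "set_integrable lborel E (F c)" "set_integrable lborel E (F 1)" by auto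
  qed
  also have "\<dots> = (\<integral>y. (\<integral>s. indicator {1..c} s * (indicator E y * G s y) \<partial>lborel) \<partial>lborel)"
    unfolding set_lebesgue_integral_def
  proof (rule Bochner_Integration.integral_cong[OF refl])
    fix y
    have "(\<integral>s. G s y * indicator {1..c} s \<partial>lborel) = F c y - F 1 y"
    proof (rule integral_FTC_Icc_real[OF c(1) dF])
      have "continuous_on UNIV (\<lambda>s. G s y)"
        using continuous_on_compose2[OF cG, of UNIV "\<lambda>s. (s, y)"] by (simp add: continuous_on_Pair)
      then show "isCont (\<lambda>s. G s y) s" for s by (simp add: continuous_on_eq_continuous_at)
    qed
    then show "indicator E y *\<^sub>R (F c y - F 1 y) = (\<integral>s. indicator {1..c} s * (indicator E y * G s y) \<partial>lborel)"
      by (cases "y \<in> E") (simp_all add: mult_ac)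
  qed
  also have "\<dots> = (\<integral>s. (\<integral>y. indicator {1..c} s * (indicator E y * G s y) \<partial>lborel) \<partial>lborel)"
    by (rule lborel_pair.Fubini_integral[OF int])
  also have "\<dots> \<le> (\<integral>s. indicator {1..c} s * (2 ^ ?d * D * p) \<partial>lborel)"
  proof (rule integral_mono)
    show "integrable lborel (\<lambda>s. \<integral>y. indicator {1..c} s * (indicator E y * G s y) \<partial>lborel)"
      using lborel_pair.integrable_fst[OF int] by simp
    show "integrable lborel (\<lambda>s. indicator {1..c} s * (2 ^ ?d * D * p))"
      by (intro integrable_mult_left integrable_real_indicator emeasure_bounded_finite) auto
    show "(\<integral>y. indicator {1..c} s * (indicator E y * G s y) \<partial>lborel) \<le> indicator {1..c} s * (2 ^ ?d * D * p)" for s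
      using flux[of s] c by (cases "s \<in> {1..c}") (auto simp: set_lebesgue_integral_def)
  qed
  also have "\<dots> = (c - 1) * (2 ^ ?d * D * p)" using c by simp
  finally show ?thesis by (simp add: F_def A_def)
qed

text \<open>
  The integral of \<open>indicator A - indicator B\<close> against its own sign is \<open>|A| + |B|\<close>, and the sign is almost
  attained by smooth functions: inner approximation gives compact \<open>P \<subseteq> A\<close> and \<open>Q \<subseteq> B\<close> of almost full measure, and
  \<open>\<phi>\<close> is the difference of a bump on \<open>P\<close> that vanishes on \<open>Q\<close> and a bump on \<open>Q\<close> that vanishes on \<open>P\<close>.
\<close>

lemma measure_add_le_of_smooth_pairing:
  fixes U :: "'a::euclidean_space set"
  assumes U: "open U" "bounded U" and A: "A \<in> sets borel" "A \<subseteq> U" and B: "B \<in> sets borel" "B \<subseteq> U"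
    and AB: "A \<inter> B = {}"
    and K: "\<And>\<phi> L. \<phi> \<in> flat_algebra \<Longrightarrow> (\<And>x. \<bar>\<phi> x\<bar> \<le> 1) \<Longrightarrow> compact L \<Longrightarrow> L \<subseteq> U \<Longrightarrow>
        (\<And>x. x \<notin> L \<Longrightarrow> \<phi> x = 0) \<Longrightarrow> (\<integral>x. \<phi> x * (indicator A x - indicator B x) \<partial>lborel) \<le> K"
  shows "measure lborel A + measure lborel B \<le> K"
proof (rule field_le_epsilon)
  fix \<epsilon> :: real assume "\<epsilon> > 0"
  \<comment> \<open>The losses add up to \<open>\<eta> (|A| + |B|)\<close> from the height of the bumps and \<open>4 \<eta>\<close> from the sets \<open>A - P\<close>, \<open>B - Q\<close>, each counted twice.\<close>
  define \<eta> where "\<eta> = \<epsilon> / (measure lborel A + measure lborel B + 4)"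
  have den: "measure lborel A + measure lborel B + 4 > 0"
    by (smt (verit) measure_nonneg)
  have "\<eta> > 0" using \<open>\<epsilon> > 0\<close> den by (simp add: \<eta>_def)
  have inner: "\<exists>Q. compact Q \<and> Q \<subseteq> S \<and> measure lborel (S - Q) < \<eta>" if S: "S \<in> sets borel" "S \<subseteq> U" for S
  proof -
    have "S \<in> sets lebesgue" using S(1) by (simp add: sets_completionI_sets)
    from sets_lebesgue_inner_closed[OF this \<open>\<eta> > 0\<close>]
    obtain Q where Q: "closed Q" "Q \<subseteq> S" "S - Q \<in> lmeasurable" "emeasure lebesgue (S - Q) < ennreal \<eta>" .
    have "emeasure lborel (S - Q) < ennreal \<eta>"
      using Q S(1) by (simp add: emeasure_completion)
    moreover have "emeasure lborel (S - Q) = ennreal (measure lborel (S - Q))"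
      using calculation by (intro emeasure_eq_ennreal_measure) auto
    ultimately have "measure lborel (S - Q) < \<eta>"
      using \<open>\<eta> > 0\<close> by (simp add: ennreal_less_iff)
    moreover have "bounded Q" using Q(2) S(2) U(2) bounded_subset by blast
    ultimately show ?thesis using Q compact_eq_bounded_closed by blast
  qed
  obtain P where P: "compact P" "P \<subseteq> A" "measure lborel (A - P) < \<eta>" using inner[OF A] by blast
  obtain Q where Q: "compact Q" "Q \<subseteq> B" "measure lborel (B - Q) < \<eta>" using inner[OF B] by blast
  have op: "open (U - P)" "open (U - Q)" using U(1) P(1) Q(1) by (auto intro: open_Diff compact_imp_closed)
  have PQ: "P \<subseteq> U - Q" "Q \<subseteq> U - P" using P(2) Q(2) A(2) B(2) AB by blast+
  obtain f L where f: "f \<in> flat_algebra" "\<And>x. 0 \<le> f x" "\<And>x. f x \<le> 1" "\<And>x. x \<in> P \<Longrightarrow> 1 - \<eta> \<le> f x"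
    "compact L" "L \<subseteq> U - Q" "\<And>x. x \<notin> L \<Longrightarrow> f x = 0"
    using flat_algebra_Urysohn[OF P(1) op(2) PQ(1) \<open>\<eta> > 0\<close>] by blast
  obtain g N where g: "g \<in> flat_algebra" "\<And>x. 0 \<le> g x" "\<And>x. g x \<le> 1" "\<And>x. x \<in> Q \<Longrightarrow> 1 - \<eta> \<le> g x"
    "compact N" "N \<subseteq> U - P" "\<And>x. x \<notin> N \<Longrightarrow> g x = 0"
    using flat_algebra_Urysohn[OF Q(1) op(1) PQ(2) \<open>\<eta> > 0\<close>] by blast
  define \<phi> where "\<phi> x = f x - g x" for x
  have fin: "emeasure lborel S < \<infinity>" if "S \<subseteq> U" for S
    using bounded_subset[OF U(2) that] by (rule emeasure_bounded_finite)
  note [measurable] = A(1) B(1) borel_compact[OF P(1)] borel_compact[OF Q(1)]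
  have [measurable]: "\<phi> \<in> borel_measurable borel"
    unfolding \<phi>_def using flat_algebra_continuous f(1) g(1)
    by (intro borel_measurable_diff borel_measurable_continuous_onI)
  have mA: "measure lborel (A - P) = measure lborel A - measure lborel P"
    and mB: "measure lborel (B - Q) = measure lborel B - measure lborel Q"
    using P(2) Q(2) fin[OF A(2)] fin[OF B(2)] by (auto intro!: measure_Diff)
  have ii: "integrable lborel (\<lambda>x. indicator S x :: real)" if "S \<subseteq> U" "S \<in> sets borel" for S
    using fin[OF that(1)] that(2) by (intro integrable_real_indicator) auto
  have sub: "P \<subseteq> U" "Q \<subseteq> U" "A - P \<subseteq> U" "B - Q \<subseteq> U" using P(2) Q(2) A(2) B(2) by auto
  have abs\<phi>: "\<bar>\<phi> x\<bar> \<le> 1" for x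
    using f(2,3)[of x] g(2,3)[of x] by (simp add: \<phi>_def abs_le_iff)
  have "(1 - \<eta>) * (measure lborel P + measure lborel Q) - (measure lborel (A - P) + measure lborel (B - Q))
      = (\<integral>x. (1 - \<eta>) * (indicator P x + indicator Q x) - (indicator (A - P) x + indicator (B - Q) x) \<partial>lborel)"
    using ii[OF sub(1)] ii[OF sub(2)] ii[OF sub(3)] ii[OF sub(4)] by simp
  also have "\<dots> \<le> (\<integral>x. \<phi> x * (indicator A x - indicator B x) \<partial>lborel)"
  proof (rule integral_mono)
    show "integrable lborel (\<lambda>x. (1 - \<eta>) * (indicator P x + indicator Q x) - (indicator (A - P) x + indicator (B - Q) x))"
      using ii[OF sub(1)] ii[OF sub(2)] ii[OF sub(3)] ii[OF sub(4)] by simp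
    show "integrable lborel (\<lambda>x. \<phi> x * (indicator A x - indicator B x))"
    proof (rule Bochner_Integration.integrable_bound)
      show "integrable lborel (\<lambda>x. indicator A x + indicator B x :: real)"
        using ii[OF A(2,1)] ii[OF B(2,1)] by simp
      show "AE x in lborel. norm (\<phi> x * (indicator A x - indicator B x)) \<le> norm (indicator A x + indicator B x :: real)"
        using abs\<phi> AB by (auto simp: indicator_def abs_mult)
    qed measurable
    fix x
    consider "x \<in> P" | "x \<in> Q" | "x \<in> A - P" | "x \<in> B - Q" | "x \<notin> A \<union> B" by blast
    then show "(1 - \<eta>) * (indicator P x + indicator Q x) - (indicator (A - P) x + indicator (B - Q) x)
        \<le> \<phi> x * (indicator A x - indicator B x)"
    proof cases
      case 1
      then have "x \<in> A" "x \<notin> B" "x \<notin> Q" "x \<notin> N" using P(2) Q(2) AB g(6) by auto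
      with 1 f(4)[OF 1] g(7) show ?thesis by (simp add: \<phi>_def)
    next
      case 2
      then have "x \<in> B" "x \<notin> A" "x \<notin> P" "x \<notin> L" using P(2) Q(2) AB f(6) by auto
      with 2 g(4)[OF 2] f(7) show ?thesis by (simp add: \<phi>_def)
    next
      case 3
      then have "x \<notin> B" "x \<notin> Q" using Q AB by auto
      with 3 abs\<phi>[of x] show ?thesis by simp
    next
      case 4
      then have "x \<notin> A" "x \<notin> P" using P AB by auto
      with 4 abs\<phi>[of x] show ?thesis by simp
    next
      case 5
      then have "x \<notin> P" "x \<notin> Q" using P Q by auto
      with 5 show ?thesis by simp
    qed
  qed
  also have "\<dots> \<le> K"
  proof (rule K)
    show "\<phi> \<in> flat_algebra" unfolding \<phi>_def by (rule flat_algebra_diff[OF f(1) g(1)])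
    show "compact (L \<union> N)" using f(5) g(5) by (rule compact_Un)
    show "L \<union> N \<subseteq> U" using f(6) g(6) by auto
    show "\<phi> x = 0" if "x \<notin> L \<union> N" for x using that f(7) g(7) by (simp add: \<phi>_def)
  qed (rule abs\<phi>)
  finally have "(1 - \<eta>) * (measure lborel P + measure lborel Q) - 2 * \<eta> \<le> K"
    using P(3) Q(3) by linarith
  moreover have "\<eta> * (measure lborel P + measure lborel Q) \<le> \<eta> * (measure lborel A + measure lborel B)"
    using mA mB \<open>\<eta> > 0\<close> measure_nonneg[of lborel "A - P"] measure_nonneg[of lborel "B - Q"]
    by (intro mult_left_mono) linarith+
  moreover have "\<eta> * (measure lborel A + measure lborel B) + 4 * \<eta> = \<epsilon>"
  proof -
    have "\<eta> * (measure lborel A + measure lborel B + 4) = \<epsilon>" using den by (simp add: \<eta>_def)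
    then show ?thesis by (simp only: distrib_left mult.commute[of \<eta> 4])
  qed
  ultimately show "measure lborel A + measure lborel B \<le> K + \<epsilon>"
    using P(3) Q(3) mA mB by (simp add: algebra_simps)
qed

text \<open>
  The map \<open>x \<mapsto> (1 - \<tau>) x + \<tau> z\<close> moves points of \<open>C\<close> by at most \<open>\<tau> D\<close>, and the perimeter bounds the measure of the
  points that it carries across the boundary of \<open>E\<close>. Formally, changing variables in \<open>scaling_flux_le\<close> with
  \<open>c = 1 / (1 - \<tau>)\<close> turns its left-hand side into the integral of \<open>\<phi>\<close> against the indicator of the points that enter
  \<open>E\<close> minus the indicator of those that leave it, and \<open>measure_add_le_of_smooth_pairing\<close> removes \<open>\<phi>\<close>. The
  Jacobian of the contraction is bounded below because \<open>\<tau> \<le> 1 / 2\<close>.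
\<close>

lemma contraction_crossing_le:
  fixes C E :: "'a::euclidean_space set"
  assumes C: "convex C" "compact C" "z \<in> C" and D: "0 < D" "\<And>x. x \<in> C \<Longrightarrow> dist z x \<le> D"
    and E: "E \<in> sets borel" "E \<subseteq> C"
    and p: "0 \<le> p" "\<And>\<xi>. \<xi> \<in> test_fields C \<Longrightarrow> (LINT y:E|lborel. divergence \<xi> y) \<le> p"
    and \<tau>: "0 \<le> \<tau>" "\<tau> \<le> 1 / 2"
  shows "measure lborel {x \<in> C. (x \<in> E) \<noteq> ((1 - \<tau>) *\<^sub>R x + \<tau> *\<^sub>R z \<in> E)} \<le> \<tau> * (2 ^ (DIM('a) + 1) * D * p)"
proof -
  let ?d = "DIM('a)" let ?U = "interior C"
  define S where "S x = (1 - \<tau>) *\<^sub>R x + \<tau> *\<^sub>R z" for x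
  define c where "c = 1 / (1 - \<tau>)"
  have ca: "c * (1 - \<tau>) = 1" using \<tau> by (simp add: c_def)
  have c: "1 \<le> c" "c \<le> 2" "c - 1 \<le> 2 * \<tau>"
  proof -
    have "c - 1 = \<tau> / (1 - \<tau>)" using \<tau> by (simp add: c_def field_simps)
    also have "\<dots> \<le> \<tau> / (1 / 2)" using \<tau> by (intro divide_left_mono) auto
    finally show "c - 1 \<le> 2 * \<tau>" by simp
    then show "c \<le> 2" using \<tau> by simp
    show "1 \<le> c" using \<tau> by (simp add: c_def)
  qed
  note [measurable] = E(1) borel_compact[OF C(2)] borel_open[OF open_interior[of C]]
  have [measurable]: "S \<in> borel_measurable borel"
    unfolding S_def by (intro borel_measurable_continuous_onI continuous_intros)
  define A where "A = {x. x \<in> ?U \<and> S x \<in> E \<and> x \<notin> E}"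
  define B where "B = {x. x \<in> ?U \<and> x \<in> E \<and> S x \<notin> E}"
  have AB: "A \<in> sets borel" "B \<in> sets borel" unfolding A_def B_def by measurable
  have bC: "bounded C" by (rule compact_imp_bounded[OF C(2)])
  have "measure lborel A + measure lborel B \<le> (c - 1) * (2 ^ ?d * D * p)"
  proof (rule measure_add_le_of_smooth_pairing[of ?U])
    show "bounded ?U" using bC bounded_interior by blast
    fix \<phi> :: "'a \<Rightarrow> real" and L
    assume \<phi>: "\<phi> \<in> flat_algebra" "\<And>x. \<bar>\<phi> x\<bar> \<le> 1" and L: "compact L" "L \<subseteq> ?U"
      and 0: "\<And>x. x \<notin> L \<Longrightarrow> \<phi> x = 0"
    have [measurable]: "\<phi> \<in> borel_measurable borel"
      by (intro borel_measurable_continuous_onI flat_algebra_continuous \<phi>)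
    have iL: "integrable lborel (\<lambda>x. indicator L x :: real)"
      using L(1) by (intro integrable_real_indicator emeasure_bounded_finite) (auto intro: borel_compact compact_imp_bounded)
    have bound: "\<bar>\<phi> x * indicator Q y\<bar> \<le> indicator L x" for x y :: 'a and Q :: "'a set"
      using \<phi>(2)[of x] 0[of x] by (cases "x \<in> L") (auto simp: indicator_def)
    have i1: "integrable lborel (\<lambda>x. \<phi> x * indicator E (S x))"
      by (rule Bochner_Integration.integrable_bound[OF iL]) (use bound in auto)
    have i2: "integrable lborel (\<lambda>x. \<phi> x * indicator E x)"
      by (rule Bochner_Integration.integrable_bound[OF iL]) (use bound in auto)
    have "(\<integral>x. \<phi> x * (indicator A x - indicator B x) \<partial>lborel)
        = (\<integral>x. \<phi> x * indicator E (S x) - \<phi> x * indicator E x \<partial>lborel)"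
    proof (rule Bochner_Integration.integral_cong[OF refl])
      fix x show "\<phi> x * (indicator A x - indicator B x) = \<phi> x * indicator E (S x) - \<phi> x * indicator E x"
        using 0[of x] L(2) by (cases "x \<in> L") (auto simp: A_def B_def indicator_def)
    qed
    also have "\<dots> = (\<integral>x. \<phi> x * indicator E (S x) \<partial>lborel) - (\<integral>x. \<phi> x * indicator E x \<partial>lborel)"
      by (rule Bochner_Integration.integral_diff[OF i1 i2])
    also have "(\<integral>x. \<phi> x * indicator E x \<partial>lborel) = (LINT y:E|lborel. \<phi> y)"
      by (simp add: set_lebesgue_integral_def mult.commute)
    also have "(\<integral>x. \<phi> x * indicator E (S x) \<partial>lborel)
        = (LINT y:E|lborel. c ^ ?d * \<phi> ((1 - c) *\<^sub>R z + c *\<^sub>R y))"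
    proof -
      let ?f = "\<lambda>y. indicator E y * (c ^ ?d * \<phi> ((1 - c) *\<^sub>R z + c *\<^sub>R y)) :: real"
      have eq: "(1 - c) *\<^sub>R z + c *\<^sub>R (\<tau> *\<^sub>R z + (1 - \<tau>) *\<^sub>R x) = x" for x
      proof -
        have "(1 - c) *\<^sub>R z + c *\<^sub>R (\<tau> *\<^sub>R z + (1 - \<tau>) *\<^sub>R x)
            = (1 - c * (1 - \<tau>)) *\<^sub>R z + (c * (1 - \<tau>)) *\<^sub>R x"
          by (simp add: algebra_simps)
        then show ?thesis unfolding ca by simp
      qed
      have "(\<integral>y. ?f y \<partial>lborel) = (1 - \<tau>) ^ ?d * (\<integral>x. ?f (\<tau> *\<^sub>R z + (1 - \<tau>) *\<^sub>R x) \<partial>lborel)"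
        using \<tau> by (intro lborel_integral_affine) auto
      also have "\<dots> = (\<integral>x. (1 - \<tau>) ^ ?d * ?f (\<tau> *\<^sub>R z + (1 - \<tau>) *\<^sub>R x) \<partial>lborel)"
        by simp
      also have "\<dots> = (\<integral>x. \<phi> x * indicator E (S x) \<partial>lborel)"
      proof (rule Bochner_Integration.integral_cong[OF refl])
        fix x
        have "(1 - \<tau>) ^ ?d * c ^ ?d = 1"
          using ca by (simp add: power_mult_distrib[symmetric] mult.commute)
        then show "(1 - \<tau>) ^ ?d * ?f (\<tau> *\<^sub>R z + (1 - \<tau>) *\<^sub>R x) = \<phi> x * indicator E (S x)"
          unfolding eq by (simp add: S_def add.commute)
      qed
      finally show ?thesis by (simp only: set_lebesgue_integral_def real_scaleR_def)
    qed
    also have "(LINT y:E|lborel. c ^ ?d * \<phi> ((1 - c) *\<^sub>R z + c *\<^sub>R y)) - (LINT y:E|lborel. \<phi> y)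
        \<le> (c - 1) * (2 ^ ?d * D * p)"
      by (rule scaling_flux_le[OF C D E p(2) \<phi> 0 L c(1,2)])
    finally show "(\<integral>x. \<phi> x * (indicator A x - indicator B x) \<partial>lborel) \<le> (c - 1) * (2 ^ ?d * D * p)" .
  qed (use AB in \<open>auto simp: A_def B_def\<close>)
  also have "\<dots> \<le> 2 * \<tau> * (2 ^ ?d * D * p)"
    using c(3) D(1) p(1) by (intro mult_right_mono) auto
  finally have le: "measure lborel A + measure lborel B \<le> \<tau> * (2 ^ (?d + 1) * D * p)" by simp
  have null: "frontier C \<in> null_sets lborel"
    using negligible_convex_frontier[OF C(1)]
    by (simp add: negligible_iff_null_sets null_sets_completion_iff)
  have "(A \<union> B) \<union> frontier C \<subseteq> C"
    using interior_subset frontier_subset_compact[OF C(2)] by (auto simp: A_def B_def)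
  then have fm: "(A \<union> B) \<union> frontier C \<in> fmeasurable lborel"
    using AB null bounded_subset[OF bC] by (intro fmeasurableI emeasure_bounded_finite) auto
  have "measure lborel {x \<in> C. (x \<in> E) \<noteq> (S x \<in> E)} \<le> measure lborel ((A \<union> B) \<union> frontier C)"
  proof (rule measure_mono_fmeasurable[OF _ _ fm])
    show "{x \<in> C. (x \<in> E) \<noteq> (S x \<in> E)} \<subseteq> (A \<union> B) \<union> frontier C"
      using closure_subset[of C] by (auto simp: A_def B_def frontier_def)
    show "{x \<in> C. (x \<in> E) \<noteq> (S x \<in> E)} \<in> sets lborel" by measurable
  qed
  also have "\<dots> = measure lborel (A \<union> B)"
    using AB null by (intro measure_Un_null_set) auto
  also have "\<dots> \<le> measure lborel A + measure lborel B"
    using AB by (intro measure_Un_le) auto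
  finally show ?thesis using le by (simp add: S_def)
qed

section \<open>Pairs of points separated by the set\<close>

definition crossing_pairs :: "'a::real_vector set \<Rightarrow> 'a set \<Rightarrow> real \<Rightarrow> ('a \<times> 'a) set" where
  "crossing_pairs C E \<tau> = {(x, z) \<in> C \<times> C. (x \<in> E) \<noteq> ((1 - \<tau>) *\<^sub>R x + \<tau> *\<^sub>R z \<in> E)}"

text \<open>
  This symmetry allows the estimates to be used for whichever of \<open>E\<close> and \<open>C - E\<close> is smaller, although only
  the perimeter of \<open>E\<close> is at hand.
\<close>

lemma crossing_pairs_compl:
  assumes "convex C" "E \<subseteq> C" "0 \<le> \<tau>" "\<tau> \<le> 1"
  shows "crossing_pairs C (C - E) \<tau> = crossing_pairs C E \<tau>"
proof -
  have "(1 - \<tau>) *\<^sub>R x + \<tau> *\<^sub>R z \<in> C" if "x \<in> C" "z \<in> C" for x z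
    using assms that by (intro convexD) auto
  then show ?thesis by (auto simp: crossing_pairs_def)
qed

lemma borel_crossing_pairs:
  fixes C E :: "'a::euclidean_space set"
  assumes [measurable]: "C \<in> sets borel" "E \<in> sets borel"
  shows "crossing_pairs C E \<tau> \<in> sets (borel \<Otimes>\<^sub>M borel)"
proof -
  have "crossing_pairs C E \<tau> = {x \<in> space (borel \<Otimes>\<^sub>M borel). fst x \<in> C \<and> snd x \<in> C \<and>
      (fst x \<in> E) \<noteq> ((1 - \<tau>) *\<^sub>R fst x + \<tau> *\<^sub>R snd x \<in> E)}"
    by (auto simp: crossing_pairs_def space_pair_measure)
  also have "\<dots> \<in> sets (borel \<Otimes>\<^sub>M borel)" by measurable
  finally show ?thesis .
qed

text \<open>
  Integration over \<open>z\<close> of the measures of the slices with fixed \<open>z\<close>. The same slices, taken in the other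
  coordinate, serve for the transposed set, which enters through \<open>midpoint_crossing_pairs\<close>.
\<close>

lemma emeasure_crossing_pairs_le:
  fixes C E :: "'a::euclidean_space set"
  assumes C: "C \<in> sets borel" "bounded C" and E: "E \<in> sets borel" and "0 \<le> m"
    and m: "\<And>z. z \<in> C \<Longrightarrow> measure lborel {x \<in> C. (x \<in> E) \<noteq> ((1 - \<tau>) *\<^sub>R x + \<tau> *\<^sub>R z \<in> E)} \<le> m"
  shows "emeasure (lborel \<Otimes>\<^sub>M lborel) (crossing_pairs C E \<tau>) \<le> ennreal (m * measure lborel C)"
    and "emeasure (lborel \<Otimes>\<^sub>M lborel) (prod.swap ` crossing_pairs C E \<tau>) \<le> ennreal (m * measure lborel C)"
    and "prod.swap ` crossing_pairs C E \<tau> \<in> sets (borel \<Otimes>\<^sub>M borel)"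
proof -
  let ?W = "crossing_pairs C E \<tau>"
  have W: "?W \<in> sets (lborel \<Otimes>\<^sub>M lborel)"
    using borel_crossing_pairs[OF C(1) E] by (simp cong: sets_pair_measure_cong)
  have swap: "prod.swap ` ?W = (\<lambda>x. (snd x, fst x)) -` ?W \<inter> space (borel \<Otimes>\<^sub>M borel)"
    by (force simp: space_pair_measure)
  show swapm: "prod.swap ` ?W \<in> sets (borel \<Otimes>\<^sub>M borel)"
    unfolding swap by (rule measurable_sets[OF _ borel_crossing_pairs[OF C(1) E]]) measurable
  have slice: "emeasure lborel {x. (x, z) \<in> ?W} \<le> ennreal m * indicator C z" for z
  proof (cases "z \<in> C")
    case True
    then have "{x. (x, z) \<in> ?W} = {x \<in> C. (x \<in> E) \<noteq> ((1 - \<tau>) *\<^sub>R x + \<tau> *\<^sub>R z \<in> E)}"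
      by (auto simp: crossing_pairs_def)
    moreover have "emeasure lborel {x \<in> C. (x \<in> E) \<noteq> ((1 - \<tau>) *\<^sub>R x + \<tau> *\<^sub>R z \<in> E)} < \<infinity>"
      by (intro emeasure_bounded_finite bounded_subset[OF C(2)]) auto
    ultimately show ?thesis
      using True m[OF True] by (simp add: emeasure_eq_ennreal_measure ennreal_leI)
  qed (simp add: crossing_pairs_def)
  have "(\<integral>\<^sup>+z. emeasure lborel {x. (x, z) \<in> ?W} \<partial>lborel) \<le> (\<integral>\<^sup>+z. ennreal m * indicator C z \<partial>lborel)"
    by (intro nn_integral_mono slice)
  also have "\<dots> = ennreal m * emeasure lborel C"
    using C(1) by (simp add: nn_integral_cmult_indicator)
  also have "\<dots> = ennreal (m * measure lborel C)"
    using emeasure_bounded_finite[OF C(2)] \<open>0 \<le> m\<close>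
    by (simp add: emeasure_eq_ennreal_measure ennreal_mult)
  finally have *: "(\<integral>\<^sup>+z. emeasure lborel {x. (x, z) \<in> ?W} \<partial>lborel) \<le> ennreal (m * measure lborel C)" .
  show "emeasure (lborel \<Otimes>\<^sub>M lborel) ?W \<le> ennreal (m * measure lborel C)"
    using * by (subst lborel_pair.emeasure_pair_measure_alt2[OF W]) (simp add: vimage_def)
  have sw: "Pair z -` (prod.swap ` ?W) = {x. (x, z) \<in> ?W}" for z by force
  have "prod.swap ` ?W \<in> sets (lborel \<Otimes>\<^sub>M lborel)"
    using swapm by (simp cong: sets_pair_measure_cong)
  then show "emeasure (lborel \<Otimes>\<^sub>M lborel) (prod.swap ` ?W) \<le> ennreal (m * measure lborel C)"
    using * by (subst lborel.emeasure_pair_measure_alt) (simp_all add: sw)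
qed

text \<open>
  From a fixed \<open>x\<close> in \<open>F\<close>, the points \<open>(1 - \<tau>) x + \<tau> z\<close> with \<open>z\<close> in \<open>C\<close> fill a copy of \<open>C\<close> scaled by \<open>\<tau>\<close>. If its volume
  exceeds that of \<open>F\<close>, then many of them miss \<open>F\<close>. This is the step that produces the power \<open>1 - 1/d\<close> in the
  isoperimetric inequality, since \<open>\<tau>\<close> can be taken as small as the scale \<open>(|F| / |C|)\<^sup>1\<^sup>/\<^sup>d\<close>.
\<close>

lemma crossing_pairs_lower_bound:
  fixes C F :: "'a::euclidean_space set"
  assumes C: "C \<in> sets borel" "bounded C" and F: "F \<in> sets borel" "F \<subseteq> C" and \<tau>: "0 < \<tau>"
    and nonneg: "measure lborel F / \<tau> ^ DIM('a) \<le> measure lborel C"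
  shows "ennreal (measure lborel F * (measure lborel C - measure lborel F / \<tau> ^ DIM('a)))
    \<le> emeasure (lborel \<Otimes>\<^sub>M lborel) (crossing_pairs C F \<tau>)"
proof -
  let ?W = "crossing_pairs C F \<tau>" and ?q = "measure lborel C - measure lborel F / \<tau> ^ DIM('a)"
  have W: "?W \<in> sets (lborel \<Otimes>\<^sub>M lborel)"
    using borel_crossing_pairs[OF C(1) F(1)] by (simp cong: sets_pair_measure_cong)
  note [measurable] = C(1) F(1)
  have fin: "emeasure lborel Q \<noteq> \<infinity>" if "Q \<subseteq> C" for Q
    using emeasure_bounded_finite[OF bounded_subset[OF C(2) that]] by simp
  have slice: "ennreal ?q * indicator F x \<le> emeasure lborel (Pair x -` ?W)" for x
  proof (cases "x \<in> F")
    case True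
    define Q where "Q = {z. (1 - \<tau>) *\<^sub>R x + \<tau> *\<^sub>R z \<in> F}"
    have [measurable]: "Q \<in> sets borel" unfolding Q_def by measurable
    have "ennreal (measure lborel F) = ennreal (\<tau> ^ DIM('a)) * emeasure lborel Q"
      unfolding Q_def emeasure_lborel_affine[OF F(1) \<tau>, of "(1 - \<tau>) *\<^sub>R x", symmetric]
      using fin[OF F(2)] by (intro emeasure_eq_ennreal_measure[symmetric]) simp
    moreover have "ennreal (measure lborel F) = ennreal (\<tau> ^ DIM('a)) * ennreal (measure lborel F / \<tau> ^ DIM('a))"
      using \<tau> by (simp add: ennreal_mult[symmetric])
    ultimately have Q: "emeasure lborel Q = ennreal (measure lborel F / \<tau> ^ DIM('a))"
      using \<tau> by (simp add: ennreal_mult_cancel_left)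
    have "ennreal ?q = ennreal (measure lborel C) - emeasure lborel Q"
      unfolding Q using \<tau> by (intro ennreal_minus[symmetric]) simp
    also have "\<dots> = emeasure lborel C - emeasure lborel Q"
      using fin[of C] by (simp add: emeasure_eq_ennreal_measure)
    also have "\<dots> \<le> emeasure lborel C - emeasure lborel (C \<inter> Q)"
      by (intro ennreal_minus_mono emeasure_mono) auto
    also have "\<dots> = emeasure lborel (C - C \<inter> Q)"
      using fin[of "C \<inter> Q"] by (intro emeasure_Diff[symmetric]) auto
    also have "C - C \<inter> Q = Pair x -` ?W"
      using True F(2) by (auto simp: crossing_pairs_def Q_def)
    finally show ?thesis using True by simp
  qed simp
  have "ennreal (measure lborel F * ?q) = ennreal ?q * emeasure lborel F"
    using nonneg fin[OF F(2)] by (simp add: emeasure_eq_ennreal_measure ennreal_mult mult.commute)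
  also have "\<dots> = (\<integral>\<^sup>+x. ennreal ?q * indicator F x \<partial>lborel)"
    by (simp add: nn_integral_cmult_indicator)
  also have "\<dots> \<le> (\<integral>\<^sup>+x. emeasure lborel (Pair x -` ?W) \<partial>lborel)"
    by (intro nn_integral_mono slice)
  also have "\<dots> = emeasure (lborel \<Otimes>\<^sub>M lborel) ?W"
    by (rule lborel.emeasure_pair_measure_alt[OF W, symmetric])
  finally show ?thesis .
qed

text \<open>
  Between a point of \<open>F\<close> and a point outside \<open>F\<close>, one of the two halves of the segment has its ends on different
  sides of \<open>F\<close>.
\<close>

lemma midpoint_crossing_pairs:
  "F \<times> (C - F) \<subseteq> crossing_pairs C F (1 / 2) \<union> prod.swap ` crossing_pairs C F (1 / 2)"
  if "F \<subseteq> C"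
proof clarify
  fix x z assume *: "x \<in> F" "z \<in> C" "z \<notin> F" "(x, z) \<notin> prod.swap ` crossing_pairs C F (1 / 2)"
  then have "(z, x) \<notin> crossing_pairs C F (1 / 2)" by force
  then show "(x, z) \<in> crossing_pairs C F (1 / 2)"
    using * that by (auto simp: crossing_pairs_def add.commute)
qed

section \<open>The isoperimetric inequality\<close>

text \<open>
  Let \<open>F\<close> be the smaller of \<open>E\<close> and \<open>C - E\<close>, with volume \<open>f\<close>. The contraction ratio \<open>\<tau>\<close> is chosen such that a copy of \<open>C\<close>
  scaled by \<open>\<tau>\<close> has twice the volume of \<open>F\<close>; then the two bounds for the set of crossing pairs give \<open>f \<le> const \<tau> D p\<close>,
  which is the claim because \<open>f / \<tau>\<close> is its left-hand side. If this \<open>\<tau>\<close> exceeds \<open>1 / 2\<close>, then \<open>F\<close> takes up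
  a fixed fraction of \<open>C\<close> and the linear bound \<open>f \<le> const D p\<close>, obtained from midpoints, is as good.
\<close>

lemma relative_isoperimetric_borel:
  fixes C E :: "'a::euclidean_space set"
  assumes C: "convex C" "compact C" "0 < measure lborel C"
    and D: "0 < D" "\<And>x z. x \<in> C \<Longrightarrow> z \<in> C \<Longrightarrow> dist z x \<le> D"
    and E: "E \<in> sets borel" "E \<subseteq> C"
    and p: "0 \<le> p" "\<And>\<xi>. \<xi> \<in> test_fields C \<Longrightarrow> (LINT y:E|lborel. divergence \<xi> y) \<le> p"
  shows "min (measure lborel E) (measure lborel C - measure lborel E) powr (1 - 1 / DIM('a))
      * (measure lborel C / 2) powr (1 / DIM('a)) \<le> 2 ^ (DIM('a) + 3) * D * p"
proof -
  let ?d = "DIM('a)"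
  define V where "V = measure lborel C"
  define K where "K = 2 ^ (?d + 1) * D * p"
  have K: "0 \<le> K" using D(1) p(1) by (simp add: K_def)
  have V: "0 < V" using C(3) by (simp add: V_def)
  have bC: "C \<in> sets borel" "bounded C"
    using C(2) by (auto intro: borel_compact compact_imp_bounded)
  have fin: "emeasure lborel Q \<noteq> \<infinity>" if "Q \<subseteq> C" for Q
    using emeasure_bounded_finite[OF bounded_subset[OF bC(2) that]] by simp
  define F where "F = (if measure lborel E \<le> V - measure lborel E then E else C - E)"
  define f where "f = measure lborel F"
  have mCE: "measure lborel (C - E) = V - measure lborel E"
    unfolding V_def using E bC fin[of C] fin[of E] by (intro measure_Diff) auto
  have f_min: "f = min (measure lborel E) (V - measure lborel E)"
    by (simp add: f_def F_def mCE)
  have F: "F \<in> sets borel" "F \<subseteq> C" using E bC by (auto simp: F_def)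
  have f: "0 \<le> f" "f \<le> V / 2" 
    using f_min measure_nonneg[of lborel F] by (auto simp only: f_def[symmetric] min_def split: if_splits)
  have cross: "crossing_pairs C F \<tau> = crossing_pairs C E \<tau>" if "0 < \<tau>" "\<tau> \<le> 1 / 2" for \<tau>
    using crossing_pairs_compl[OF C(1) E(2), of \<tau>] that by (simp add: F_def)
  have slices: "measure lborel {x \<in> C. (x \<in> E) \<noteq> ((1 - \<tau>) *\<^sub>R x + \<tau> *\<^sub>R z \<in> E)} \<le> \<tau> * K"
    if "0 < \<tau>" "\<tau> \<le> 1 / 2" "z \<in> C" for \<tau> z
    unfolding K_def using that
    by (intro contraction_crossing_le[OF C(1,2) _ D(1) _ E p]) (auto intro: D(2))
  have upper: "emeasure (lborel \<Otimes>\<^sub>M lborel) (crossing_pairs C F \<tau>) \<le> ennreal (\<tau> * K * V)"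
    "emeasure (lborel \<Otimes>\<^sub>M lborel) (prod.swap ` crossing_pairs C F \<tau>) \<le> ennreal (\<tau> * K * V)"
    "prod.swap ` crossing_pairs C F \<tau> \<in> sets (borel \<Otimes>\<^sub>M borel)"
    if \<tau>: "0 < \<tau>" "\<tau> \<le> 1 / 2" for \<tau>
    using emeasure_crossing_pairs_le[OF bC E(1), of "\<tau> * K" \<tau>] slices[OF \<tau>] K \<tau>
    unfolding cross[OF \<tau>] V_def by auto
  have "f powr (1 - 1 / ?d) * (V / 2) powr (1 / ?d) \<le> 4 * K"
  proof (cases "f = 0")
    case False
    then have f0: "f > 0" using f by simp
    define \<tau> where "\<tau> = (f / (V / 2)) powr (1 / ?d)"
    have \<tau>0: "\<tau> > 0" using f0 V by (simp add: \<tau>_def)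
    have f_split: "f powr (1 - 1 / ?d) * (V / 2) powr (1 / ?d) = f / \<tau>"
    proof -
      have "\<tau> = f powr (1 / ?d) / (V / 2) powr (1 / ?d)"
        unfolding \<tau>_def by (rule powr_divide)
      moreover have "f powr (1 - 1 / ?d) = f / f powr (1 / ?d)"
        using f0 by (simp add: powr_diff)
      ultimately show ?thesis using f0 V by simp
    qed
    have "f / \<tau> \<le> 4 * K"
    proof (cases "\<tau> \<le> 1 / 2")
      case True
      have "\<tau> ^ ?d = f / (V / 2)"
        using f0 V unfolding \<tau>_def by (simp add: powr_realpow[symmetric] powr_powr)
      then have half: "f / \<tau> ^ ?d = V / 2" using f0 V by simp
      have "ennreal (f * (V - f / \<tau> ^ ?d)) \<le> ennreal (\<tau> * K * V)"
        using crossing_pairs_lower_bound[OF bC F \<tau>0] upper(1)[OF \<tau>0 True] half V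
        unfolding f_def[symmetric] V_def[symmetric] by (auto intro: order_trans)
      then have "f * (V / 2) \<le> \<tau> * K * V"
        using K \<tau>0 V unfolding half by (simp add: ennreal_le_iff)
      then have "f \<le> 2 * \<tau> * K" using V by (simp add: field_simps)
      then have "f / \<tau> \<le> 2 * K" using \<tau>0 by (simp add: field_simps)
      then show ?thesis using K by simp
    next
      case False
      let ?W = "crossing_pairs C F (1 / 2)"
      have W: "?W \<in> sets (lborel \<Otimes>\<^sub>M lborel)" "prod.swap ` ?W \<in> sets (lborel \<Otimes>\<^sub>M lborel)"
        using borel_crossing_pairs[OF bC(1) F(1)] upper(3)[of "1 / 2"]
        by (simp_all cong: sets_pair_measure_cong)
      have mCF: "measure lborel (C - F) = V - f"
        unfolding V_def f_def using F bC fin[of C] fin[of F] by (intro measure_Diff) auto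
      have "ennreal (f * (V - f)) = emeasure (lborel \<Otimes>\<^sub>M lborel) (F \<times> (C - F))"
        using F bC fin[of F] fin[of "C - F"] f V mCF
        by (subst lborel.emeasure_pair_measure_Times)
          (auto simp: emeasure_eq_ennreal_measure f_def[symmetric] ennreal_mult)
      also have "\<dots> \<le> emeasure (lborel \<Otimes>\<^sub>M lborel) (?W \<union> prod.swap ` ?W)"
        by (intro emeasure_mono midpoint_crossing_pairs F) (use W in auto)
      also have "\<dots> \<le> emeasure (lborel \<Otimes>\<^sub>M lborel) ?W + emeasure (lborel \<Otimes>\<^sub>M lborel) (prod.swap ` ?W)"
        by (rule emeasure_subadditive[OF W])
      also have "\<dots> \<le> ennreal (1 / 2 * K * V) + ennreal (1 / 2 * K * V)"
        by (intro add_mono upper) auto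
      also have "\<dots> = ennreal (K * V)"
        using K V by (simp add: ennreal_plus[symmetric] del: ennreal_plus)
      finally have "f * (V - f) \<le> K * V"
        using K V by (simp add: ennreal_le_iff)
      moreover have "f * (V / 2) \<le> f * (V - f)" using f by (intro mult_left_mono) auto
      ultimately have "f * (V / 2) \<le> K * V" by linarith
      then have "f \<le> 2 * K" using V by (simp add: field_simps)
      moreover have "f / \<tau> \<le> f / (1 / 2)" using False f0 \<tau>0 by (intro divide_left_mono) auto
      ultimately show ?thesis by simp
    qed
    then show ?thesis using f_split by simp
  qed (use K in simp)
  also have "4 * K = 2 ^ (?d + 3) * D * p" by (simp add: K_def power_add)
  finally show ?thesis by (simp add: f_min V_def)
qed

lemma continuous_on_divergence:
  assumes "\<xi> \<in> test_fields C"
  shows "continuous_on UNIV (divergence \<xi>)"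
proof -
  have "ck_map (Suc 0) \<xi>" using assms by (simp add: test_fields_def smooth_map_def)
  then show ?thesis unfolding divergence_def by (auto intro!: continuous_intros)
qed

lemma zero_test_field: "(\<lambda>x. 0) \<in> test_fields C"
proof -
  have "smooth_map (\<lambda>x::'a. 0::'a)"
    by (rule smooth_map_componentwise) (simp add: flat_algebra.const)
  then show ?thesis by (simp add: test_fields_def)
qed

lemma relative_perimeter_nonneg: "0 \<le> relative_perimeter C E"
proof -
  have "divergence (\<lambda>x::'a. 0::'a) = (\<lambda>x. 0)"
    by (simp add: divergence_def fun_eq_iff)
  then have "ereal (set_lebesgue_integral lebesgue E (divergence (\<lambda>x. 0))) = 0"
    by (simp add: set_lebesgue_integral_def)
  then show ?thesis
    unfolding relative_perimeter_def using SUP_upper[OF zero_test_field[of C]] by metis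
qed

text \<open>
  Fubini's theorem is applied to products of Lebesgue-Borel measures, so a Lebesgue measurable set is first
  replaced by a Borel subset of full measure, which has the same volume and the same flux integrals.
\<close>

lemma borel_representative:
  assumes "E \<in> sets lebesgue"
  obtains S :: "'a::euclidean_space set" where "S \<in> sets borel" "S \<subseteq> E" "measure lborel S = measure lebesgue E"
    "\<And>g::'a \<Rightarrow> real. continuous_on UNIV g \<Longrightarrow> (LINT y:S|lborel. g y) = (LINT y:E|lebesgue. g y)"
proof -
  obtain S N N' where S: "E = S \<union> N" "N \<subseteq> N'" "N' \<in> null_sets lborel" "S \<in> sets lborel"
    using sets_completionE[OF assms] by blast
  have null: "N' \<in> null_sets lebesgue" by (rule null_sets_completionI[OF S(3)])
  have Sl: "S \<in> sets lebesgue" using S(4) by (simp add: sets_completionI_sets)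
  have ae: "AE x in lebesgue. indicator S x = (indicator E x :: real)"
    using AE_not_in[OF null] by eventually_elim (use S in \<open>auto simp: indicator_def\<close>)
  show ?thesis
  proof
    show "S \<in> sets borel" "S \<subseteq> E" using S by auto
    have "emeasure lebesgue S = emeasure lebesgue E"
      using ae Sl assms by (intro emeasure_eq_AE) (auto elim!: eventually_mono simp: indicator_def split: if_splits)
    then show "measure lborel S = measure lebesgue E"
      using S(4) by (simp add: measure_def emeasure_completion)
    fix g :: "'a \<Rightarrow> real" assume "continuous_on UNIV g"
    then have g: "g \<in> borel_measurable borel" by (rule borel_measurable_continuous_onI)
    then have gl: "g \<in> borel_measurable lebesgue" by (simp add: measurable_completion)
    have "(LINT y:E|lebesgue. g y) = (LINT y:S|lebesgue. g y)"
      unfolding set_lebesgue_integral_def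
    proof (rule integral_cong_AE)
      show "AE x in lebesgue. indicator E x *\<^sub>R g x = indicator S x *\<^sub>R g x"
        using ae by eventually_elim simp
    qed (use gl Sl assms in \<open>auto intro!: borel_measurable_scaleR borel_measurable_indicator\<close>)
    also have "\<dots> = (LINT y:S|lborel. g y)"
      unfolding set_lebesgue_integral_def using g S(4)
      by (intro integral_completion) (auto intro!: borel_measurable_scaleR borel_measurable_indicator)
    finally show "(LINT y:S|lborel. g y) = (LINT y:E|lebesgue. g y)" by simp
  qed
qed

text \<open>
  The inner ball bounds the volume of \<open>C\<close> from below by a multiple of \<open>r\<^sup>d\<close>, the outer ball bounds its diameter
  by \<open>2 R\<close>; the constant depends on both only through \<open>R / r\<close>.
\<close>

lemma relative_isoperimetric:
  fixes C E :: "'a::euclidean_space set"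
  assumes C: "convex C" "compact C" and r: "0 < r" "0 < R" "cball y r \<subseteq> C" "C \<subseteq> cball x R"
    and E: "E \<in> sets lebesgue" "E \<subseteq> C"
  shows "ereal ((unit_ball_vol (DIM('a)) / 2) powr (1 / DIM('a)) / 2 ^ (DIM('a) + 4) / (R / r)
      * min (measure lebesgue E) (measure lebesgue C - measure lebesgue E) powr (1 - 1 / DIM('a)))
    \<le> relative_perimeter C E"
proof (cases "relative_perimeter C E")
  case (real p)
  let ?d = "DIM('a)"
  obtain S where S: "S \<in> sets borel" "S \<subseteq> E" "measure lborel S = measure lebesgue E"
    "\<And>g::'a \<Rightarrow> real. continuous_on UNIV g \<Longrightarrow> (LINT y:S|lborel. g y) = (LINT y:E|lebesgue. g y)"
    using borel_representative[OF E(1)] by blast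
  have mC: "measure lborel C = measure lebesgue C"
    using borel_compact[OF C(2)] by (simp add: measure_completion)
  have "unit_ball_vol ?d * r ^ ?d = measure lborel (cball y r)"
    using r(1) by (simp add: content_cball)
  also have "\<dots> \<le> measure lborel C"
    using r(3) borel_compact[OF C(2)] emeasure_bounded_finite[OF compact_imp_bounded[OF C(2)]]
    by (intro measure_mono_fmeasurable fmeasurableI) auto
  finally have vol: "unit_ball_vol ?d * r ^ ?d \<le> measure lborel C" .
  have w: "unit_ball_vol ?d > 0" by simp
  have pos: "0 < measure lborel C" using vol w r(1) by (smt (verit) mult_pos_pos zero_less_power)
  have diam: "dist v u \<le> 2 * R" if "u \<in> C" "v \<in> C" for u v
  proof -
    have "dist x u \<le> R" "dist x v \<le> R" using that r(4) by auto
    then show ?thesis using dist_triangle3[of v u x] by simp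
  qed
  let ?f = "min (measure lebesgue E) (measure lebesgue C - measure lebesgue E) powr (1 - 1 / ?d)"
  have "?f * (measure lborel C / 2) powr (1 / ?d) \<le> 2 ^ (?d + 3) * (2 * R) * p"
    unfolding mC[symmetric] S(3)[symmetric]
  proof (rule relative_isoperimetric_borel[OF C pos _ diam S(1)])
    show "S \<subseteq> C" using S(2) E(2) by blast
    show "0 \<le> p" using relative_perimeter_nonneg[of C E] real by simp
    fix \<xi> assume \<xi>: "\<xi> \<in> test_fields C"
    have "ereal (LINT y:E|lebesgue. divergence \<xi> y) \<le> relative_perimeter C E"
      unfolding relative_perimeter_def by (rule SUP_upper[OF \<xi>])
    then show "(LINT y:S|lborel. divergence \<xi> y) \<le> p"
      using S(4)[OF continuous_on_divergence[OF \<xi>]] real by simp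
  qed (use r in auto)
  moreover have "(unit_ball_vol ?d / 2) powr (1 / ?d) * r \<le> (measure lborel C / 2) powr (1 / ?d)"
  proof -
    have "(unit_ball_vol ?d / 2) powr (1 / ?d) * r = (unit_ball_vol ?d / 2 * r ^ ?d) powr (1 / ?d)"
    proof -
      have "(r ^ ?d) powr (1 / ?d) = r"
        using r(1) by (simp add: powr_realpow[symmetric] powr_powr)
      then show ?thesis using w r(1) by (subst powr_mult) auto
    qed
    also have "\<dots> \<le> (measure lborel C / 2) powr (1 / ?d)"
      using vol w r(1) by (intro powr_mono2) auto
    finally show ?thesis .
  qed
  then have "?f * ((unit_ball_vol ?d / 2) powr (1 / ?d) * r) \<le> ?f * (measure lborel C / 2) powr (1 / ?d)"
    by (intro mult_left_mono) auto
  ultimately have "?f * ((unit_ball_vol ?d / 2) powr (1 / ?d) * r) \<le> 2 ^ (?d + 4) * R * p"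
    by (simp add: power_add)
  then have "(unit_ball_vol ?d / 2) powr (1 / ?d) / 2 ^ (?d + 4) / (R / r) * ?f \<le> p"
    using r by (simp add: field_simps)
  then show ?thesis using real by simp
qed (use relative_perimeter_nonneg[of C E] in auto)

theorem theorem4p11:
  fixes n :: nat
  assumes "n \<ge> 1" and "CARD('n::finite) = n + 1"
  shows "\<exists>M :: real \<Rightarrow> real. (\<forall>\<rho>. M \<rho> > 0) \<and>
    (\<forall>(C :: (real ^ 'n) set) x y r R.
       convex_body C \<and> x \<in> C \<and> y \<in> C \<and> 0 < r \<and> r < R \<and>
       cball y r \<subseteq> C \<and> C \<subseteq> cball x R \<longrightarrow>
       (\<forall>v. 0 \<le> v \<and> v \<le> measure lebesgue C \<longrightarrow>
          isoperimetric_profile C v \<ge>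
            ereal (M (R / r) * min v (measure lebesgue C - v) powr (real n / (real n + 1)))))"
proof -
  define c where "c = (unit_ball_vol (real CARD('n)) / 2) powr (1 / real CARD('n)) / 2 ^ (CARD('n) + 4)"
  have "unit_ball_vol (real CARD('n)) > 0" by simp
  then have "unit_ball_vol (real CARD('n)) \<noteq> 0" by linarith
  then have "c > 0" by (simp add: c_def)
  have expo: "1 - 1 / real CARD('n) = real n / (real n + 1)"
    using assms(2) by (simp add: field_simps)
  show ?thesis
  \<comment> \<open>The maximum only serves to make the constant positive for every real \<open>\<rho>\<close>; here \<open>R / r > 1\<close>.\<close>
  proof (intro exI[of _ "\<lambda>\<rho>. c / max 1 \<rho>"] conjI allI impI)
    show "c / max 1 \<rho> > 0" for \<rho> using \<open>c > 0\<close> by (simp add: less_max_iff_disj)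
    fix C :: "(real ^ 'n) set" and x y r R v
    assume *: "convex_body C \<and> x \<in> C \<and> y \<in> C \<and> 0 < r \<and> r < R \<and> cball y r \<subseteq> C \<and> C \<subseteq> cball x R"
    then have max: "max 1 (R / r) = R / r" by simp
    show "ereal (c / max 1 (R / r) * min v (measure lebesgue C - v) powr (real n / (real n + 1)))
        \<le> isoperimetric_profile C v"
      unfolding isoperimetric_profile_def
    proof (rule INF_greatest)
      fix E assume "E \<in> {E. E \<in> sets lebesgue \<and> E \<subseteq> C \<and> measure lebesgue E = v}"
      then show "ereal (c / max 1 (R / r) * min v (measure lebesgue C - v) powr (real n / (real n + 1)))
          \<le> relative_perimeter C E"
        using relative_isoperimetric[of C r R y x E] *
        unfolding max c_def expo[symmetric] convex_body_def by auto
    qed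
  qed
qed

end
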